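(* Let $\beta>0$. The sequence of mm-spaces $\{\frac{1}{\sqrt n}C^n_\beta\}_{n=1}^\infty$ has no box-convergent (hence no measured Gromov–Hausdorff convergent) subsequence.
   Context: **Cauchy space.** For $\beta>0$, $C^n_\beta:=(\mathbb{R}^n,\|\cdot\|,\nu^n_\beta)$ with the Euclidean distance and $$\nu^n_\beta(dx)=\frac{\Gamma(\frac{n+\beta}{2})}{\pi^{n/2}\Gamma(\frac\beta2)}\frac{dx}{(1+\|x\|^2)^{\frac{n+\beta}{2}}}.$$ For an mm-space $X=(X,d_X,m_X)$ and $t>0$, $tX:=(X,t\,d_X,m_X)$. **Box-convergence.** An mm-space is a triple $X=(X,d_X,m_X)$ where $(X,d_X)$ is a complete separable metric space and $m_X$ is a Borel probability measure on $X$. A parameter of $X$ is a Borel map $\varphi:[0,1]\to X$ with $\varphi_\#\mathcal{L}^1=m_X$ ($\mathcal{L}^1$ is Lebesgue measure on $[0,1]$). $\square(X,Y)$ is the infimum of $\varepsilon\ge0$ for which there exist parameters $\varphi$ of $X$, $\psi$ of $Y$ and a Borel set $J\subset[0,1]$ with $\mathcal{L}^1(J)\ge1-\varepsilon$ and $|d_X(\varphi(s),\varphi(t))-d_Y(\psi(s),\psi(t))|\le\varepsilon$ for all $s,t\in J$. A sequence $X_n$ is box-convergent if there is an mm-space $X$ with $\square(X_n,X)\to0$. **Measured Gromov–Hausdorff convergence.** $X_n$ converges to $X$ in this sense if there are $\varepsilon_n\to0$ and Borel maps $f_n:X_n\to X$ with $|d_X(f_n(x),f_n(x'))-d_{X_n}(x,x')|\le\varepsilon_n$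 for all $x,x'\in X_n$, with every point of $X$ within distance $\varepsilon_n$ of $f_n(X_n)$, and with $(f_n)_\#m_{X_n}\to m_X$ weakly. *)

theory Defs
  imports "HOL-Probability.Probability"
begin

section \<open>mm-spaces\<close>

record 'a mm_triple =
  pts :: "'a set"
  dst :: "'a \<Rightarrow> 'a \<Rightarrow> real"
  msr :: "'a measure"

definition mm_space :: "'a mm_triple \<Rightarrow> bool" where
  "mm_space X \<longleftrightarrow>
     Metric_space (pts X) (dst X) \<and>
     Metric_space.mcomplete (pts X) (dst X) \<and>
     separable_space (Metric_space.mtopology (pts X) (dst X)) \<and>
     space (msr X) = pts X \<and>
     sets (msr X) =
       sigma_sets (pts X) {U. openin (Metric_space.mtopology (pts X) (dst X)) U} \<and>
     prob_space (msr X)"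

definition mm_scale :: "real \<Rightarrow> 'a mm_triple \<Rightarrow> 'a mm_triple" where
  "mm_scale t X = \<lparr>pts = pts X, dst = (\<lambda>x y. t * dst X x y), msr = msr X\<rparr>"


section \<open>Box distance and box convergence\<close>

definition unit_lebesgue :: "real measure" where
  "unit_lebesgue = restrict_space lborel {0..1}"

definition mm_parameter :: "'a mm_triple \<Rightarrow> (real \<Rightarrow> 'a) \<Rightarrow> bool" where
  "mm_parameter X \<phi> \<longleftrightarrow>
     \<phi> \<in> unit_lebesgue \<rightarrow>\<^sub>M msr X \<and> distr unit_lebesgue (msr X) \<phi> = msr X"

definition box_admissible :: "'a mm_triple \<Rightarrow> 'b mm_triple \<Rightarrow> real \<Rightarrow> bool" where
  "box_admissible X Y \<epsilon> \<longleftrightarrow> 0 \<le> \<epsilon> \<and>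
     (\<exists>\<phi> \<psi> J. mm_parameter X \<phi> \<and> mm_parameter Y \<psi> \<and>
        J \<in> sets borel \<and> J \<subseteq> {0..1} \<and> measure lborel J \<ge> 1 - \<epsilon> \<and>
        (\<forall>s\<in>J. \<forall>t\<in>J. \<bar>dst X (\<phi> s) (\<phi> t) - dst Y (\<psi> s) (\<psi> t)\<bar> \<le> \<epsilon>))"

text \<open>The infimum is taken in the extended nonnegative reals, where the infimum of the empty
  set is infinity rather than an unspecified number.\<close>
definition box_dist :: "'a mm_triple \<Rightarrow> 'b mm_triple \<Rightarrow> ennreal" where
  "box_dist X Y = (INF \<epsilon>\<in>{\<epsilon>. box_admissible X Y \<epsilon>}. ennreal \<epsilon>)"

definition box_converges :: "(nat \<Rightarrow> 'b mm_triple) \<Rightarrow> 'a mm_triple \<Rightarrow> bool" where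
  "box_converges Xs X \<longleftrightarrow> mm_space X \<and> (\<lambda>n. box_dist (Xs n) X) \<longlonglongrightarrow> 0"


section \<open>Measured Gromov-Hausdorff convergence\<close>

definition mm_weak_conv :: "'a mm_triple \<Rightarrow> (nat \<Rightarrow> 'a measure) \<Rightarrow> bool" where
  "mm_weak_conv X \<mu> \<longleftrightarrow>
     (\<forall>g. continuous_map (Metric_space.mtopology (pts X) (dst X)) euclideanreal g \<and>
          bounded (g ` pts X) \<longrightarrow>
          (\<lambda>n. integral\<^sup>L (\<mu> n) g) \<longlonglongrightarrow> integral\<^sup>L (msr X) g)"

definition mGH_converges :: "(nat \<Rightarrow> 'b mm_triple) \<Rightarrow> 'a mm_triple \<Rightarrow> bool" where
  "mGH_converges Xs X \<longleftrightarrow> mm_space X \<and>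
     (\<exists>(\<epsilon> :: nat \<Rightarrow> real) f. \<epsilon> \<longlonglongrightarrow> 0 \<and>
        (\<forall>n. f n \<in> msr (Xs n) \<rightarrow>\<^sub>M msr X) \<and>
        (\<forall>n. \<forall>x\<in>pts (Xs n). \<forall>x'\<in>pts (Xs n).
             \<bar>dst X (f n x) (f n x') - dst (Xs n) x x'\<bar> \<le> \<epsilon> n) \<and>
        (\<forall>n. \<forall>y\<in>pts X. \<exists>x\<in>pts (Xs n). dst X y (f n x) \<le> \<epsilon> n) \<and>
        mm_weak_conv X (\<lambda>n. distr (msr (Xs n)) (msr X) (f n)))"


section \<open>Cauchy spaces\<close>

text \<open>Points of n-dimensional Euclidean space are the functions on \<open>{..<n}\<close>, extended by
  \<open>undefined\<close> outside; this is the underlying set of the n-fold product of \<open>lborel\<close>, whose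
  \<open>\<sigma>\<close>-algebra is the Borel \<open>\<sigma>\<close>-algebra of the Euclidean distance.\<close>

definition cauchy_density :: "nat \<Rightarrow> real \<Rightarrow> (nat \<Rightarrow> real) \<Rightarrow> real" where
  "cauchy_density n \<beta> x =
     Gamma ((real n + \<beta>) / 2) / (pi powr (real n / 2) * Gamma (\<beta> / 2)) *
     (1 / (1 + (L2_set x {..<n})\<^sup>2) powr ((real n + \<beta>) / 2))"

definition cauchy_space :: "nat \<Rightarrow> real \<Rightarrow> (nat \<Rightarrow> real) mm_triple" where
  "cauchy_space n \<beta> =
     \<lparr>pts = {..<n} \<rightarrow>\<^sub>E UNIV,
      dst = (\<lambda>x y. L2_set (\<lambda>i. x i - y i) {..<n}),
      msr = density (\<Pi>\<^sub>M i\<in>{..<n}. lborel) (\<lambda>x. ennreal (cauchy_density n \<beta> x))\<rparr>"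

end

theory Submission
  imports Defs "HOL-Combinatorics.Permutations"
begin

text \<open>If the sequence converged, then finitely many balls, their number being bounded along the
  sequence and their radius being a small multiple of \<open>sqrt n\<close>, would carry most of the Cauchy
  measure. A ball away from the origin lies in a cone around its centre \<open>c\<close>. Invariance under sign
  flips and permutations of the coordinates gives the function \<open>(c \<bullet> y)\<^sup>2 / \<parallel>y\<parallel>\<^sup>2\<close> the mean
  \<open>\<parallel>c\<parallel>\<^sup>2 / n\<close>, so by Markov's inequality the cone has mass at most \<open>4 / n\<close>. The balls near the
  origin lie in a ball of radius \<open>sqrt (R * n)\<close>; comparing its mass with that of its dilate by 2
  shows that it is at most \<open>1 / 4\<close> for small \<open>R\<close>. Only ratios of masses occur, so the
  normalisation of the Cauchy measure plays no role.\<close>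

section \<open>Symmetries of Lebesgue measure\<close>

lemma product_sigma_finite_lborel: "product_sigma_finite (\<lambda>_. lborel :: real measure)"
  by (simp add: product_sigma_finite_def sigma_finite_lborel)

lemma measurable_coordinate_scaling [measurable]:
  "(\<lambda>x. \<lambda>i\<in>I. a i * x i) \<in> PiM I (\<lambda>_. lborel :: real measure) \<rightarrow>\<^sub>M PiM I (\<lambda>_. lborel)"
  by (rule measurable_restrict) measurable

lemma measurable_coordinate_permutation:
  assumes "p permutes I"
  shows "(\<lambda>x. \<lambda>i\<in>I. x (p i)) \<in> PiM I (\<lambda>_. lborel :: real measure) \<rightarrow>\<^sub>M PiM I (\<lambda>_. lborel)"
proof (rule measurable_restrict)
  fix i assume "i \<in> I"
  then have "p i \<in> I" using assms by (simp add: permutes_in_image)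
  then show "(\<lambda>x. x (p i)) \<in> PiM I (\<lambda>_. lborel :: real measure) \<rightarrow>\<^sub>M lborel"
    by (rule measurable_component_singleton)
qed

text \<open>Both sides agree on boxes, where the claim splits into one-dimensional changes of
  variables, and boxes determine the product measure. Entries of absolute value 1 give the sign
  flips, the constant entry 2 gives the dilation.\<close>

lemma PiM_lborel_scale:
  fixes a :: "'i \<Rightarrow> real"
  assumes fin: "finite I" and a: "\<And>i. i \<in> I \<Longrightarrow> a i \<noteq> 0"
  shows "scale_measure (ennreal (\<Prod>i\<in>I. \<bar>a i\<bar>))
           (distr (PiM I (\<lambda>_. lborel)) (PiM I (\<lambda>_. lborel)) (\<lambda>x. \<lambda>i\<in>I. a i * x i)) =
         PiM I (\<lambda>_. lborel)"
proof -
  interpret product_sigma_finite "\<lambda>_::'i. lborel :: real measure"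
    by (rule product_sigma_finite_lborel)
  show ?thesis
  proof (rule PiM_eqI[OF fin])
    fix A :: "'i \<Rightarrow> real set" assume A: "\<And>i. i \<in> I \<Longrightarrow> A i \<in> sets lborel"
    let ?B = "\<lambda>i. (*) (a i) -` A i"
    have B: "?B i \<in> sets lborel" if "i \<in> I" for i
      using measurable_sets[of "(*) (a i)" lborel lborel "A i"] A[OF that] by simp
    have PA: "Pi\<^sub>E I A \<in> sets (PiM I (\<lambda>_. lborel))"
      using fin A by (intro sets_PiM_I_finite) auto
    have eq: "(\<lambda>x. \<lambda>i\<in>I. a i * x i) -` Pi\<^sub>E I A \<inter> space (PiM I (\<lambda>_. lborel :: real measure)) = Pi\<^sub>E I ?B"
      by (auto simp: space_PiM PiE_iff)
    have one: "ennreal \<bar>a i\<bar> * emeasure lborel (?B i) = emeasure lborel (A i)" if i: "i \<in> I" for i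
    proof -
      have "emeasure lborel (A i) = emeasure (density (distr lborel borel ((*) (a i))) (\<lambda>_. \<bar>a i\<bar>)) (A i)"
        using lborel_distr_mult'[OF a[OF i]] by simp
      also have "\<dots> = ennreal \<bar>a i\<bar> * emeasure lborel (?B i)"
        using A[OF i] by (simp add: emeasure_density_const emeasure_distr)
      finally show ?thesis by simp
    qed
    have "emeasure (scale_measure (ennreal (\<Prod>i\<in>I. \<bar>a i\<bar>))
           (distr (PiM I (\<lambda>_. lborel)) (PiM I (\<lambda>_. lborel)) (\<lambda>x. \<lambda>i\<in>I. a i * x i))) (Pi\<^sub>E I A) =
        ennreal (\<Prod>i\<in>I. \<bar>a i\<bar>) * (\<Prod>i\<in>I. emeasure lborel (?B i))"
      using PA by (simp add: emeasure_distr eq emeasure_PiM[OF fin B])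
    also have "\<dots> = (\<Prod>i\<in>I. ennreal \<bar>a i\<bar> * emeasure lborel (?B i))"
      by (subst prod_ennreal[symmetric]) (simp_all add: prod.distrib)
    also have "\<dots> = (\<Prod>i\<in>I. emeasure lborel (A i))"
      by (intro prod.cong one refl)
    finally show "emeasure (scale_measure (ennreal (\<Prod>i\<in>I. \<bar>a i\<bar>))
           (distr (PiM I (\<lambda>_. lborel)) (PiM I (\<lambda>_. lborel)) (\<lambda>x. \<lambda>i\<in>I. a i * x i))) (Pi\<^sub>E I A) =
           (\<Prod>i\<in>I. emeasure lborel (A i))" .
  qed simp
qed

text \<open>The preimage of a box is the box with its sides permuted by \<open>inv p\<close>, so its
  volume has the same factors in another order.\<close>

lemma PiM_lborel_permute:
  assumes fin: "finite I" and p: "p permutes I"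
  shows "distr (PiM I (\<lambda>_. lborel :: real measure)) (PiM I (\<lambda>_. lborel)) (\<lambda>x. \<lambda>i\<in>I. x (p i)) =
         PiM I (\<lambda>_. lborel)"
proof -
  interpret product_sigma_finite "\<lambda>_::'a. lborel :: real measure"
    by (rule product_sigma_finite_lborel)
  show ?thesis
  proof (rule PiM_eqI[OF fin])
    fix A :: "'a \<Rightarrow> real set" assume A: "\<And>i. i \<in> I \<Longrightarrow> A i \<in> sets lborel"
    let ?B = "\<lambda>i. A (inv p i)"
    have ip: "inv p i \<in> I" if "i \<in> I" for i
      using permutes_in_image[OF permutes_inv[OF p]] that by blast
    have PA: "Pi\<^sub>E I A \<in> sets (PiM I (\<lambda>_. lborel))"
      using fin A by (intro sets_PiM_I_finite) auto
    have eq: "(\<lambda>x. \<lambda>i\<in>I. x (p i)) -` Pi\<^sub>E I A \<inter> space (PiM I (\<lambda>_. lborel :: real measure)) = Pi\<^sub>E I ?B"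
    proof -
      have "(\<forall>i\<in>I. x (p i) \<in> A i) \<longleftrightarrow> (\<forall>i\<in>I. x i \<in> A (inv p i))" for x
        using p ip by (metis permutes_inverses(1,2) permutes_in_image)
      then show ?thesis by (auto simp: space_PiM PiE_iff)
    qed
    have "(\<Prod>i\<in>I. emeasure lborel (?B i)) = (\<Prod>i\<in>I. emeasure lborel (A i))"
      using prod.permute[OF permutes_inv[OF p], of "\<lambda>i. emeasure lborel (A i)"] by (simp add: o_def)
    then show "emeasure (distr (PiM I (\<lambda>_. lborel)) (PiM I (\<lambda>_. lborel)) (\<lambda>x. \<lambda>i\<in>I. x (p i))) (Pi\<^sub>E I A) =
           (\<Prod>i\<in>I. emeasure lborel (A i))"
      using PA A ip fin
      by (simp add: emeasure_distr[OF measurable_coordinate_permutation[OF p]] eq emeasure_PiM)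
  qed simp
qed

text \<open>Pulling \<open>h\<close> back through the push-forward replaces it by its composition
  with \<open>T\<close>, which is \<open>h\<close> again. This carries symmetries of Lebesgue
  measure over to the Cauchy measure.\<close>

lemma distr_density_invariant:
  assumes h: "h \<in> borel_measurable M" and T: "T \<in> M \<rightarrow>\<^sub>M M"
    and inv: "distr M M T = M" and hT: "\<And>x. x \<in> space M \<Longrightarrow> h (T x) = h x"
  shows "distr (density M h) (density M h) T = density M h"
proof -
  have "density M h = density (distr M M T) h" by (simp only: inv)
  also have "\<dots> = distr (density M (\<lambda>x. h (T x))) M T"
    by (rule density_distr[OF h T])
  also have "density M (\<lambda>x. h (T x)) = density M h"
    by (rule density_cong) (use h measurable_compose[OF T h] hT in simp_all)
  also have "distr (density M h) M T = distr (density M h) (density M h) T"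
    by (rule distr_cong) simp_all
  finally show ?thesis by (rule sym)
qed

section \<open>Balls away from the origin\<close>

lemma L2_set_power2: "(L2_set f A)\<^sup>2 = (\<Sum>i\<in>A. (f i)\<^sup>2)"
  by (simp add: L2_set_def sum_nonneg)

text \<open>Each of the two squares is bounded by the whole sum separately, which covers
  \<open>i = j\<close> as well. The bound makes the quotients
  \<open>y i * y j / \<parallel>y\<parallel>\<^sup>2\<close> integrable for a finite
  measure.\<close>

lemma abs_mult_le_sum_squares:
  fixes y :: "'i \<Rightarrow> real"
  assumes "finite I" "i \<in> I" "j \<in> I"
  shows "\<bar>y i * y j\<bar> \<le> (\<Sum>k\<in>I. (y k)\<^sup>2)"
proof -
  have "(y i)\<^sup>2 \<le> (\<Sum>k\<in>I. (y k)\<^sup>2)" "(y j)\<^sup>2 \<le> (\<Sum>k\<in>I. (y k)\<^sup>2)"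
    using assms by (auto intro!: member_le_sum)
  moreover have "2 * \<bar>y i * y j\<bar> \<le> (y i)\<^sup>2 + (y j)\<^sup>2"
    using sum_squares_bound[of "\<bar>y i\<bar>" "\<bar>y j\<bar>"] by (simp add: abs_mult)
  ultimately show ?thesis by linarith
qed

text \<open>By the sign flips \<open>y i * y j / \<parallel>y\<parallel>\<^sup>2\<close> integrates to \<open>0\<close> for \<open>i \<noteq> j\<close>; by the transpositions its
  integral for \<open>i = j\<close> does not depend on \<open>i\<close>, and the diagonal terms add up to at most 1.\<close>

lemma integral_inner_square_le:
  fixes M :: "('i \<Rightarrow> real) measure"
  assumes fin: "finite I" and ne: "I \<noteq> {}"
    and sets_M: "sets M = sets (PiM I (\<lambda>_. lborel))" and finM: "finite_measure M"
    and flip: "\<And>i. i \<in> I \<Longrightarrow> distr M M (\<lambda>y. \<lambda>j\<in>I. (if j = i then -1 else 1) * y j) = M"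
    and swap: "\<And>i k. i \<in> I \<Longrightarrow> k \<in> I \<Longrightarrow> distr M M (\<lambda>y. \<lambda>j\<in>I. y (Transposition.transpose i k j)) = M"
  shows "integrable M (\<lambda>y. (\<Sum>i\<in>I. c i * y i)\<^sup>2 / (\<Sum>i\<in>I. (y i)\<^sup>2))" (is "integrable M ?g")
    and "(\<integral>y. (\<Sum>i\<in>I. c i * y i)\<^sup>2 / (\<Sum>i\<in>I. (y i)\<^sup>2) \<partial>M)
           \<le> (\<Sum>i\<in>I. (c i)\<^sup>2) * measure M (space M) / card I"
proof -
  interpret finite_measure M by (rule finM)
  have [measurable_cong]: "sets M = sets (PiM I (\<lambda>_. lborel))" by (rule sets_M)
  let ?q = "\<lambda>y. \<Sum>i\<in>I. (y i)\<^sup>2"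
  let ?e = "\<lambda>i j y. y i * y j / ?q y"
  define E where "E i j = (\<integral>y. ?e i j y \<partial>M)" for i j
  have [measurable]: "(\<lambda>y. y i) \<in> borel_measurable M" if "i \<in> I" for i
    using measurable_component_singleton[OF that, of "\<lambda>_. lborel"] sets_M by (simp cong: measurable_cong_sets)
  have meas_e [measurable]: "?e i j \<in> borel_measurable M" if "i \<in> I" "j \<in> I" for i j
    using that by measurable
  have int_e: "integrable M (?e i j)" if "i \<in> I" "j \<in> I" for i j
  proof (rule integrable_const_bound[of _ 1])
    have "\<bar>?e i j y\<bar> \<le> 1" for y :: "'i \<Rightarrow> real"
    proof -
      have "\<bar>?e i j y\<bar> = \<bar>y i * y j\<bar> / ?q y"
        using sum_nonneg[of I "\<lambda>k. (y k)\<^sup>2"] by (simp add: abs_divide)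
      \<comment> \<open>If \<open>y\<close> vanishes on \<open>I\<close>, the denominator is 0 and
        the quotient is 0 by convention.\<close>
      also have "\<dots> \<le> 1"
        using abs_mult_le_sum_squares[OF fin that, of y] sum_nonneg[of I "\<lambda>k. (y k)\<^sup>2"]
        unfolding divide_le_eq_1 by auto
      finally show ?thesis .
    qed
    then show "AE y in M. norm (?e i j y) \<le> 1" by simp
  qed (rule meas_e[OF that])
  have off: "E i j = 0" if ij: "i \<in> I" "j \<in> I" "i \<noteq> j" for i j
  proof -
    let ?T = "\<lambda>y. \<lambda>k\<in>I. (if k = i then -1 else 1) * y k :: real"
    have [measurable]: "?T \<in> M \<rightarrow>\<^sub>M M"
      using measurable_coordinate_scaling[where a = "\<lambda>k. if k = i then -1 else 1" and I = I] sets_M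
      by (simp cong: measurable_cong_sets)
    have q: "?q (?T y) = ?q y" for y
      by (intro sum.cong) auto
    have "E i j = integral\<^sup>L (distr M M ?T) (?e i j)"
      by (simp add: E_def flip[OF ij(1)])
    also have "\<dots> = (\<integral>y. ?e i j (?T y) \<partial>M)"
      using ij by (intro integral_distr) measurable
    also have "\<dots> = (\<integral>y. - ?e i j y \<partial>M)"
      unfolding q using ij by (intro Bochner_Integration.integral_cong) auto
    also have "\<dots> = - E i j" by (simp add: E_def)
    finally show ?thesis by simp
  qed
  have diag: "E i i = E k k" if ik: "i \<in> I" "k \<in> I" for i k
  proof -
    let ?T = "\<lambda>y. \<lambda>j\<in>I. y (Transposition.transpose i k j) :: real"
    have p: "Transposition.transpose i k permutes I" using ik by (rule permutes_swap_id)
    have [measurable]: "?T \<in> M \<rightarrow>\<^sub>M M"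
      using measurable_coordinate_permutation[OF p] sets_M by (simp cong: measurable_cong_sets)
    have q: "?q (?T y) = ?q y" for y
      using sum.permute[OF p, of "\<lambda>i. (y i)\<^sup>2"] by (simp add: o_def)
    have "E i i = integral\<^sup>L (distr M M ?T) (?e i i)"
      by (simp add: E_def swap[OF ik])
    also have "\<dots> = (\<integral>y. ?e i i (?T y) \<partial>M)"
      using ik by (intro integral_distr) measurable
    also have "\<dots> = E k k"
      unfolding q E_def using ik by (intro Bochner_Integration.integral_cong) auto
    finally show ?thesis .
  qed
  have E_le: "E i i \<le> measure M (space M) / card I" if i: "i \<in> I" for i
  proof -
    have "real (card I) * E i i = (\<Sum>k\<in>I. E k k)"
    proof -
      have "(\<Sum>k\<in>I. E k k) = (\<Sum>k\<in>I. E i i)"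
        using diag[OF i] by (intro sum.cong) auto
      then show ?thesis by simp
    qed
    also have "\<dots> = (\<integral>y. (\<Sum>k\<in>I. ?e k k y) \<partial>M)"
      unfolding E_def by (rule Bochner_Integration.integral_sum[symmetric]) (rule int_e)
    also have "\<dots> \<le> (\<integral>y. 1 \<partial>M)"
    proof (rule integral_mono)
      \<comment> \<open>The sum is 1 except where \<open>y\<close> vanishes on \<open>I\<close>;
        there division by zero makes it 0, hence only an inequality.\<close>
      show "(\<Sum>k\<in>I. ?e k k y) \<le> 1" for y :: "'i \<Rightarrow> real"
      proof -
        have eq: "(\<Sum>k\<in>I. ?e k k y) = ?q y / ?q y"
          by (simp only: power2_eq_square sum_divide_distrib)
        show ?thesis unfolding eq by simp
      qed
    qed (auto intro: int_e)
    finally show ?thesis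
      using fin ne by (simp add: field_simps card_gt_0_iff)
  qed
  have g_eq: "?g = (\<lambda>y. \<Sum>i\<in>I. \<Sum>j\<in>I. c i * c j * ?e i j y)"
  proof
    fix y
    have "(\<Sum>i\<in>I. c i * y i)\<^sup>2 = (\<Sum>i\<in>I. \<Sum>j\<in>I. c i * c j * (y i * y j))"
      by (simp add: power2_eq_square sum_product mult_ac)
    then show "?g y = (\<Sum>i\<in>I. \<Sum>j\<in>I. c i * c j * ?e i j y)"
      by (simp only: sum_divide_distrib times_divide_eq_right)
  qed
  show int_g: "integrable M ?g"
    unfolding g_eq by (intro Bochner_Integration.integrable_sum integrable_mult_right int_e)
  have "(\<integral>y. ?g y \<partial>M) = (\<Sum>i\<in>I. \<Sum>j\<in>I. c i * c j * E i j)"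
  proof -
    have "(\<integral>y. ?g y \<partial>M) = (\<Sum>i\<in>I. \<integral>y. (\<Sum>j\<in>I. c i * c j * ?e i j y) \<partial>M)"
      unfolding g_eq
      by (intro Bochner_Integration.integral_sum Bochner_Integration.integrable_sum integrable_mult_right int_e)
    also have "\<dots> = (\<Sum>i\<in>I. \<Sum>j\<in>I. \<integral>y. c i * c j * ?e i j y \<partial>M)"
      by (intro sum.cong refl Bochner_Integration.integral_sum integrable_mult_right int_e)
    finally show ?thesis
      unfolding E_def by (simp only: integral_mult_right_zero)
  qed
  also have "\<dots> = (\<Sum>i\<in>I. \<Sum>j\<in>I. if i = j then (c i)\<^sup>2 * E i i else 0)"
    by (intro sum.cong refl) (auto simp: off power2_eq_square)
  also have "\<dots> = (\<Sum>i\<in>I. (c i)\<^sup>2 * E i i)"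
    using fin by simp
  also have "\<dots> \<le> (\<Sum>i\<in>I. (c i)\<^sup>2 * (measure M (space M) / card I))"
    by (intro sum_mono mult_left_mono E_le) auto
  finally show "(\<integral>y. ?g y \<partial>M) \<le> (\<Sum>i\<in>I. (c i)\<^sup>2) * measure M (space M) / card I"
    by (simp add: sum_distrib_right sum_divide_distrib)
qed

text \<open>The set on the left lies in the cone of vectors at angle at most \<open>\<pi>/3\<close> to \<open>c\<close>.\<close>

lemma measure_far_ball_le:
  fixes M :: "('i \<Rightarrow> real) measure"
  assumes fin: "finite I" and ne: "I \<noteq> {}"
    and sets_M: "sets M = sets (PiM I (\<lambda>_. lborel))" and finM: "finite_measure M"
    and flip: "\<And>i. i \<in> I \<Longrightarrow> distr M M (\<lambda>y. \<lambda>j\<in>I. (if j = i then -1 else 1) * y j) = M"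
    and swap: "\<And>i k. i \<in> I \<Longrightarrow> k \<in> I \<Longrightarrow> distr M M (\<lambda>y. \<lambda>j\<in>I. y (Transposition.transpose i k j)) = M"
    and \<rho>: "0 < \<rho>"
  shows "measure M {y \<in> space M. 2 * \<rho> \<le> L2_set y I \<and> L2_set (\<lambda>i. y i - c i) I \<le> \<rho>}
           \<le> 4 * measure M (space M) / card I" (is "measure M ?A \<le> _")
proof -
  interpret finite_measure M by (rule finM)
  note int = integral_inner_square_le[OF fin ne sets_M finM flip swap, of c]
  let ?g = "\<lambda>y. (\<Sum>i\<in>I. c i * y i)\<^sup>2 / (\<Sum>i\<in>I. (y i)\<^sup>2)"
  define q where "q = (\<Sum>i\<in>I. (c i)\<^sup>2)"
  have q0: "0 \<le> q" by (simp add: q_def sum_nonneg)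
  \<comment> \<open>The angle between \<open>c\<close> and \<open>y\<close> has cosine at least 1/2,
    which gives the factor 1/4. Positivity of \<open>q\<close> is what later permits division by
    \<open>q / 4\<close>.\<close>
  have key: "q > 0 \<and> q / 4 \<le> ?g y" if y: "y \<in> ?A" for y
  proof -
    define a b s where "a = L2_set c I" and "b = L2_set y I" and "s = (\<Sum>i\<in>I. c i * y i)"
    have a: "0 \<le> a" "a\<^sup>2 = q" and b: "2 * \<rho> \<le> b" "b\<^sup>2 = (\<Sum>i\<in>I. (y i)\<^sup>2)"
      using y by (auto simp: a_def b_def q_def L2_set_power2)
    have "b > 0" using b \<rho> by linarith
    have "(L2_set (\<lambda>i. y i - c i) I)\<^sup>2 = b\<^sup>2 + a\<^sup>2 - 2 * s"
      by (simp add: b a q_def s_def L2_set_power2 power2_diff sum.distrib sum_subtractf sum_distrib_left mult_ac)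
    \<comment> \<open>The distance is at most \<open>\<rho>\<close>, and
      \<open>2 * \<rho> \<le> b\<close>.\<close>
    moreover have "(L2_set (\<lambda>i. y i - c i) I)\<^sup>2 \<le> (b / 2)\<^sup>2"
      using y b by (intro power_mono) auto
    ultimately have s: "a\<^sup>2 + 3 / 4 * b\<^sup>2 \<le> 2 * s"
      by (simp add: power_divide)
    \<comment> \<open>Completing the square shows that the left side of \<open>s\<close> is at least
      \<open>a * b\<close>.\<close>
    have "a\<^sup>2 + 3 / 4 * b\<^sup>2 - a * b = (a - b / 2)\<^sup>2 + b\<^sup>2 / 2"
      by (simp add: power2_eq_square field_simps)
    moreover have "0 \<le> (a - b / 2)\<^sup>2 + b\<^sup>2 / 2" by simp
    ultimately have "a * b \<le> 2 * s" using s by linarith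
    then have "(a * b)\<^sup>2 \<le> (2 * s)\<^sup>2" using a \<open>b > 0\<close> by (intro power_mono) auto
    then have "q / 4 \<le> s\<^sup>2 / b\<^sup>2"
      using \<open>b > 0\<close> a by (simp add: field_simps power_mult_distrib)
    \<comment> \<open>A centre at the origin would put \<open>y\<close> at distance
      \<open>b\<close>, at least \<open>2 * \<rho>\<close>, from it.\<close>
    moreover have "a \<noteq> 0"
    proof
      assume "a = 0"
      then have "c i = 0" if "i \<in> I" for i
        using that fin by (simp add: a_def L2_set_eq_0_iff)
      then have "L2_set (\<lambda>i. y i - c i) I = b" unfolding b_def by (intro L2_set_cong) auto
      then show False using y b \<rho> by auto
    qed
    ultimately show ?thesis using a b by (auto simp: s_def order.strict_iff_order)
  qed
  show ?thesis
  proof (cases "q > 0")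
    case True
    have "measure M ?A \<le> measure M {y \<in> space M. q / 4 \<le> ?g y}"
    proof (rule finite_measure_mono)
      show "{y \<in> space M. q / 4 \<le> ?g y} \<in> sets M"
        using borel_measurable_integrable[OF int(1)] by measurable
    qed (use key in auto)
    \<comment> \<open>Markov's inequality. The mean of \<open>?g\<close> is proportional to
      \<open>q\<close>, so \<open>q\<close> cancels and the bound is the same for every
      centre.\<close>
    also have "\<dots> \<le> (\<integral>y. ?g y \<partial>M) / (q / 4)"
      using True by (intro integral_Markov_inequality_measure[where A="{}"] int(1))
        (auto intro!: divide_nonneg_nonneg sum_nonneg)
    also have "\<dots> \<le> (q * measure M (space M) / card I) / (q / 4)"
      using True int(2) unfolding q_def by (intro divide_right_mono) auto
    finally show ?thesis using True by (simp add: mult.commute)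
  next
    case False
    then have A: "?A = {}" using key by blast
    show ?thesis unfolding A by simp
  qed
qed

section \<open>Cauchy measures\<close>

lemma cauchy_density_measurable [measurable]:
  "cauchy_density n \<beta> \<in> borel_measurable (PiM {..<n} (\<lambda>_. lborel))"
  unfolding cauchy_density_def L2_set_def by measurable

lemma msr_cauchy_space:
  "msr (cauchy_space n \<beta>) = density (PiM {..<n} (\<lambda>_. lborel)) (\<lambda>x. ennreal (cauchy_density n \<beta> x))"
  by (simp add: cauchy_space_def)

lemma sets_cauchy_space: "sets (msr (cauchy_space n \<beta>)) = sets (PiM {..<n} (\<lambda>_. lborel))"
  by (simp add: msr_cauchy_space)

lemma space_cauchy_space: "space (msr (cauchy_space n \<beta>)) = pts (cauchy_space n \<beta>)"
  by (simp add: cauchy_space_def space_PiM)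

section \<open>Sign flips, permutations and dilations of Cauchy measures\<close>

lemma cauchy_density_cong:
  assumes "L2_set x {..<n} = L2_set y {..<n}"
  shows "cauchy_density n \<beta> x = cauchy_density n \<beta> y"
  by (simp add: cauchy_density_def assms)

text \<open>A flip is a coordinate scaling with Jacobian 1, and the density depends on the Euclidean
  norm only.\<close>

lemma cauchy_space_flip:
  "distr (msr (cauchy_space n \<beta>)) (msr (cauchy_space n \<beta>))
     (\<lambda>y. \<lambda>j\<in>{..<n}. (if j = i then -1 else 1) * y j) = msr (cauchy_space n \<beta>)"
  unfolding msr_cauchy_space
proof (rule distr_density_invariant)
  let ?a = "\<lambda>j. if j = i then -1 else (1 :: real)"
  have "(\<Prod>j<n. \<bar>?a j\<bar>) = 1"
    by (intro prod.neutral) auto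
  then show "distr (PiM {..<n} (\<lambda>_. lborel)) (PiM {..<n} (\<lambda>_. lborel)) (\<lambda>y. \<lambda>j\<in>{..<n}. ?a j * y j) =
      PiM {..<n} (\<lambda>_. lborel)"
    using PiM_lborel_scale[of "{..<n}" ?a] by simp
  fix x :: "nat \<Rightarrow> real"
  have "L2_set (\<lambda>j\<in>{..<n}. ?a j * x j) {..<n} = L2_set x {..<n}"
    unfolding L2_set_def by (intro arg_cong[where f = sqrt] sum.cong) auto
  then show "ennreal (cauchy_density n \<beta> (\<lambda>j\<in>{..<n}. ?a j * x j)) = ennreal (cauchy_density n \<beta> x)"
    by (simp cong: cauchy_density_cong)
qed measurable

lemma cauchy_space_permute:
  assumes p: "p permutes {..<n}"
  shows "distr (msr (cauchy_space n \<beta>)) (msr (cauchy_space n \<beta>)) (\<lambda>y. \<lambda>j\<in>{..<n}. y (p j)) =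
     msr (cauchy_space n \<beta>)"
  unfolding msr_cauchy_space
proof (rule distr_density_invariant)
  fix x :: "nat \<Rightarrow> real"
  have "(\<Sum>j<n. (x (p j))\<^sup>2) = (\<Sum>j<n. (x j)\<^sup>2)"
    using sum.permute[OF p, of "\<lambda>j. (x j)\<^sup>2"] by (simp add: o_def)
  then have "L2_set (\<lambda>j\<in>{..<n}. x (p j)) {..<n} = L2_set x {..<n}"
    unfolding L2_set_def by simp
  then show "ennreal (cauchy_density n \<beta> (\<lambda>j\<in>{..<n}. x (p j))) = ennreal (cauchy_density n \<beta> x)"
    by (simp cong: cauchy_density_cong)
qed (use PiM_lborel_permute[OF _ p] measurable_coordinate_permutation[OF p] in auto)

text \<open>With \<open>s = \<parallel>y\<parallel>\<^sup>2\<close>, this compares the Cauchy density at \<open>2 * y\<close>, times the Jacobian \<open>2 ^ n\<close> of the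
  dilation, with the density at \<open>y\<close>.\<close>

lemma dilation_bound:
  fixes \<beta> s R :: real
  assumes \<beta>: "0 < \<beta>" and R: "R = 3 / (16 * (ln 4 + \<beta> * ln 2))"
    and n: "1 \<le> R * real n" and s: "0 \<le> s" "s \<le> R * real n"
  shows "4 * (1 / (1 + s) powr ((real n + \<beta>) / 2)) \<le> 2 ^ n * (1 / (1 + 4 * s) powr ((real n + \<beta>) / 2))"
proof -
  define p where "p = (real n + \<beta>) / 2"
  define L where "L = ln 4 + \<beta> * ln (2 :: real)"
  \<comment> \<open>After taking logarithms, \<open>2 * p = n + \<beta>\<close> turns the claim into
    \<open>L \<le> p * ln z\<close>: the factor 4 in \<open>z\<close> accounts for
    \<open>2 ^ n\<close> with a surplus of \<open>\<beta> * ln 2\<close>, which is the second term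
    of \<open>L\<close>.\<close>
  define z where "z = 4 * (1 + s) / (1 + 4 * s)"
  have L: "L > 0" using \<beta> by (simp add: L_def add_pos_nonneg)
  then have R0: "R > 0" by (simp add: R L_def)
  have "n > 0" using n by (cases n) auto
  have z: "z > 0" using s by (simp add: z_def)
  have "3 / (4 + 4 * s) = 1 - 1 / z" using s by (simp add: z_def field_simps)
  also have "\<dots> \<le> ln z"
    using ln_le_minus_one[of "1 / z"] z by (simp add: ln_div)
  finally have lnz: "3 / (4 + 4 * s) \<le> ln z" .
  have "L = 3 / (16 * R)" using L by (simp add: R L_def)
  also have "\<dots> = (real n / 2) * (3 / (8 * (R * real n)))"
    using R0 \<open>n > 0\<close> by (simp add: field_simps)
  \<comment> \<open>Here \<open>n / 2 \<le> p\<close>, and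
    \<open>4 + 4 * s \<le> 8 * (R * n)\<close> since both 1 and \<open>s\<close> are at most
    \<open>R * n\<close>. The value of \<open>R\<close> is the one for which the resulting bound is
    exactly \<open>L\<close>.\<close>
  also have "\<dots> \<le> p * (3 / (4 + 4 * s))"
    using \<beta> R0 s n \<open>n > 0\<close> unfolding p_def
    by (intro mult_mono divide_left_mono divide_right_mono mult_pos_pos) auto
  also have "\<dots> \<le> p * ln z"
    using lnz \<beta> by (intro mult_left_mono) (auto simp: p_def)
  also have "ln z = ln (4 * (1 + s)) - ln (1 + 4 * s)"
    unfolding z_def using s by (subst ln_div) auto
  also have "ln (4 * (1 + s)) = 2 * ln 2 + ln (1 + s)"
    using s ln_realpow[of 2 2] by (subst ln_mult) auto
  finally have "ln 4 + p * ln (1 + 4 * s) \<le> real n * ln 2 + p * ln (1 + s)"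
    unfolding L_def by (simp add: p_def field_simps)
  then have "exp (ln 4 + p * ln (1 + 4 * s)) \<le> exp (real n * ln 2 + p * ln (1 + s))"
    by simp
  then have "4 * (1 + 4 * s) powr p \<le> 2 ^ n * (1 + s) powr p"
    using s by (simp add: exp_add powr_def exp_of_nat_mult)
  then show ?thesis
    using s unfolding p_def[symmetric] by (simp add: field_simps)
qed

text \<open>Doubling all vectors of the core gives a set of at least four times its mass, and that
  mass cannot exceed the total. Finiteness of the measure allows the passage from
  \<open>emeasure\<close> to \<open>measure\<close>.\<close>

lemma measure_cauchy_core_le:
  fixes \<beta> R :: real
  assumes \<beta>: "0 < \<beta>" and R: "R = 3 / (16 * (ln 4 + \<beta> * ln 2))" and n: "1 \<le> R * real n"
    and fin: "finite_measure (msr (cauchy_space n \<beta>))"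
  shows "measure (msr (cauchy_space n \<beta>)) {y \<in> space (msr (cauchy_space n \<beta>)). L2_set y {..<n} \<le> sqrt (R * real n)}
           \<le> measure (msr (cauchy_space n \<beta>)) (space (msr (cauchy_space n \<beta>))) / 4"
proof -
  define M where "M = msr (cauchy_space n \<beta>)"
  interpret finite_measure M unfolding M_def by (rule fin)
  let ?P = "PiM {..<n} (\<lambda>_. lborel :: real measure)"
  let ?h = "\<lambda>y. ennreal (cauchy_density n \<beta> y)"
  let ?D = "\<lambda>y. \<lambda>j\<in>{..<n}. 2 * y j :: real"
  define A where "A = {y \<in> space ?P. L2_set y {..<n} \<le> sqrt (R * real n)}"
  have two: "ennreal (2 ^ n) = 2 ^ n"
    by (simp flip: ennreal_power)
  have M: "M = density ?P ?h" by (simp add: M_def msr_cauchy_space)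
  have A [measurable]: "A \<in> sets ?P"
    unfolding A_def L2_set_def by measurable
  \<comment> \<open>Off \<open>A\<close> the left side is 0. The right side carries no indicator, so
    that its integral becomes the total mass.\<close>
  have le: "4 * (?h y * indicator A y) \<le> 2 ^ n * ?h (?D y)" for y
  proof (cases "y \<in> A")
    case True
    define s where "s = (L2_set y {..<n})\<^sup>2"
    have "s \<le> (sqrt (R * real n))\<^sup>2"
      using True unfolding s_def A_def by (intro power_mono) auto
    then have s: "0 \<le> s" "s \<le> R * real n" using n by (auto simp: s_def)
    have D: "(L2_set (?D y) {..<n})\<^sup>2 = 4 * s"
      by (simp add: s_def L2_set_power2 power_mult_distrib sum_distrib_left)
    let ?c = "Gamma ((real n + \<beta>) / 2) / (pi powr (real n / 2) * Gamma (\<beta> / 2))"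
    have c: "0 \<le> ?c"
      using \<beta> by (intro divide_nonneg_nonneg mult_nonneg_nonneg less_imp_le Gamma_real_pos) auto
    have "?c * (4 * (1 / (1 + s) powr ((real n + \<beta>) / 2)))
        \<le> ?c * (2 ^ n * (1 / (1 + 4 * s) powr ((real n + \<beta>) / 2)))"
      by (rule mult_left_mono[OF dilation_bound[OF \<beta> R n s] c])
    then have "4 * cauchy_density n \<beta> y \<le> 2 ^ n * cauchy_density n \<beta> (?D y)"
      unfolding cauchy_density_def D s_def[symmetric] by (simp only: mult.left_commute[of ?c])
    then have "ennreal (4 * cauchy_density n \<beta> y) \<le> ennreal (2 ^ n * cauchy_density n \<beta> (?D y))"
      by (rule ennreal_leI)
    then show ?thesis
      using True by (simp add: ennreal_mult' two)
  qed simp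
  have D [measurable]: "?D \<in> ?P \<rightarrow>\<^sub>M ?P"
    by (rule measurable_coordinate_scaling)
  have "4 * emeasure M A = (\<integral>\<^sup>+y. 4 * (?h y * indicator A y) \<partial>?P)"
    by (simp add: M emeasure_density nn_integral_cmult)
  also have "\<dots> \<le> (\<integral>\<^sup>+y. 2 ^ n * ?h (?D y) \<partial>?P)"
    by (intro nn_integral_mono le)
  also have "\<dots> = 2 ^ n * (\<integral>\<^sup>+y. ?h (?D y) \<partial>?P)"
    by (rule nn_integral_cmult) measurable
  also have "\<dots> = 2 ^ n * (\<integral>\<^sup>+y. ?h y \<partial>distr ?P ?P ?D)"
    by (subst nn_integral_distr) measurable
  also have "\<dots> = (\<integral>\<^sup>+y. ?h y \<partial>scale_measure (2 ^ n) (distr ?P ?P ?D))"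
    by (subst nn_integral_scale_measure) measurable
  \<comment> \<open>The factor \<open>2 ^ n\<close> is the Jacobian that undoes the contraction of
    volume under the push-forward by the doubling map.\<close>
  also have "scale_measure (2 ^ n) (distr ?P ?P ?D) = ?P"
    using PiM_lborel_scale[of "{..<n}" "\<lambda>_. 2"] by (simp add: two)
  also have "(\<integral>\<^sup>+y. ?h y \<partial>?P) = emeasure M (space M)"
    by (simp add: M emeasure_density cong: nn_integral_cong)
  finally have "ennreal (4 * measure M A) \<le> ennreal (measure M (space M))"
    by (simp add: emeasure_eq_measure ennreal_mult')
  then have "measure M A \<le> measure M (space M) / 4" by simp
  moreover have "A = {y \<in> space M. L2_set y {..<n} \<le> sqrt (R * real n)}"
    by (simp add: A_def M)
  ultimately show ?thesis by (simp add: M_def)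
qed

section \<open>Unions of boundedly many balls\<close>

lemma sets_cauchy_ball:
  "{y \<in> space (msr (cauchy_space n \<beta>)). L2_set (\<lambda>i. y i - c i) {..<n} \<le> r} \<in> sets (msr (cauchy_space n \<beta>))"
proof -
  have "{y \<in> space (PiM {..<n} (\<lambda>_. lborel :: real measure)). L2_set (\<lambda>i. y i - c i) {..<n} \<le> r}
      \<in> sets (PiM {..<n} (\<lambda>_. lborel))"
    unfolding L2_set_def by measurable
  then show ?thesis by (simp add: msr_cauchy_space)
qed

text \<open>The radius refers to the rescaled metric, in which a limit space is compared; the
  Euclidean radius is \<open>r * sqrt n\<close>.\<close>

definition cauchy_balls :: "nat \<Rightarrow> real \<Rightarrow> (nat \<Rightarrow> real) set \<Rightarrow> real \<Rightarrow> (nat \<Rightarrow> real) set" where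
  "cauchy_balls n \<beta> C r =
     {y \<in> pts (cauchy_space n \<beta>). \<exists>c\<in>C. dst (mm_scale (1 / sqrt (real n)) (cauchy_space n \<beta>)) y c \<le> r}"

lemma cauchy_balls_eq:
  assumes "0 < n"
  shows "cauchy_balls n \<beta> C r =
    (\<Union>c\<in>C. {y \<in> space (msr (cauchy_space n \<beta>)). L2_set (\<lambda>i. y i - c i) {..<n} \<le> r * sqrt (real n)})"
proof -
  have "dst (mm_scale (1 / sqrt (real n)) (cauchy_space n \<beta>)) y c \<le> r \<longleftrightarrow>
      L2_set (\<lambda>i. y i - c i) {..<n} \<le> r * sqrt (real n)" for y c
    using assms by (simp add: mm_scale_def cauchy_space_def divide_le_eq)
  then show ?thesis
    by (auto simp: cauchy_balls_def space_cauchy_space)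
qed

lemma sets_cauchy_balls:
  assumes "0 < n" "finite C"
  shows "cauchy_balls n \<beta> C r \<in> sets (msr (cauchy_space n \<beta>))"
  unfolding cauchy_balls_eq[OF assms(1)] using assms(2) sets_cauchy_ball by blast

text \<open>The order of quantifiers matters: \<open>r\<close> depends on \<open>\<beta>\<close>
  alone and serves every number \<open>N\<close> of balls, only the threshold for \<open>n\<close>
  depends on \<open>N\<close>. The core and the far parts of the balls each contribute at most a
  quarter of the total mass. \<open>finite C\<close> accompanies the bound on \<open>card C\<close>
  because infinite sets have cardinality 0; finiteness of the measure is left to be supplied by the
  assumed convergence.\<close>

lemma measure_cauchy_balls_le:
  fixes \<beta> :: real
  assumes \<beta>: "0 < \<beta>"
  obtains r where "0 < r"
    "\<And>N. \<forall>\<^sub>F n in sequentially. \<forall>C. finite C \<longrightarrow> card C \<le> N \<longrightarrow> finite_measure (msr (cauchy_space n \<beta>)) \<longrightarrow>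
       measure (msr (cauchy_space n \<beta>)) (cauchy_balls n \<beta> C r)
         \<le> measure (msr (cauchy_space n \<beta>)) (space (msr (cauchy_space n \<beta>))) / 2"
proof -
  define R where "R = 3 / (16 * (ln 4 + \<beta> * ln (2 :: real)))"
  have R: "R > 0" using \<beta> by (simp add: R_def add_pos_nonneg)
  \<comment> \<open>With this value the core radius \<open>sqrt (R * n)\<close> is twice the
    Euclidean radius of the balls, as the bound for far balls demands.\<close>
  define r where "r = sqrt R / 2"
  have r: "r > 0" using R by (simp add: r_def)
  show thesis
  proof (rule that[OF r])
    fix N :: nat
    \<comment> \<open>The first condition yields \<open>1 \<le> R * n\<close> for the core; the
      second makes \<open>N\<close> far parts of relative mass \<open>4 / n\<close> add up to at
      most 1/4.\<close>
    have "\<forall>\<^sub>F n in sequentially. nat \<lceil>1 / R\<rceil> \<le> n \<and> 16 * N < n"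
      by (intro eventually_conj eventually_ge_at_top eventually_gt_at_top)
    then show "\<forall>\<^sub>F n in sequentially. \<forall>C. finite C \<longrightarrow> card C \<le> N \<longrightarrow> finite_measure (msr (cauchy_space n \<beta>)) \<longrightarrow>
       measure (msr (cauchy_space n \<beta>)) (cauchy_balls n \<beta> C r)
         \<le> measure (msr (cauchy_space n \<beta>)) (space (msr (cauchy_space n \<beta>))) / 2"
    proof (eventually_elim, intro allI impI)
      fix n :: nat and C :: "(nat \<Rightarrow> real) set"
      assume n: "nat \<lceil>1 / R\<rceil> \<le> n \<and> 16 * N < n" and C: "finite C" "card C \<le> N"
        and fin: "finite_measure (msr (cauchy_space n \<beta>))"
      define M where "M = msr (cauchy_space n \<beta>)"
      interpret finite_measure M unfolding M_def by (rule fin)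
      have n0: "n > 0" and n16: "16 * real N \<le> real n" using n by auto
      have "1 / R \<le> real n" using n by linarith
      then have nR: "1 \<le> R * real n" using R by (simp add: field_simps)
      define \<rho> where "\<rho> = r * sqrt (real n)"
      have \<rho>: "\<rho> > 0" using r n0 by (simp add: \<rho>_def)
      have core: "sqrt (R * real n) = 2 * \<rho>"
        by (simp add: \<rho>_def r_def real_sqrt_mult)
      define K where "K = {y \<in> space M. L2_set y {..<n} \<le> 2 * \<rho>}"
      define B where "B c = {y \<in> space M. 2 * \<rho> \<le> L2_set y {..<n} \<and> L2_set (\<lambda>i. y i - c i) {..<n} \<le> \<rho>}" for c
      have K: "measure M K \<le> measure M (space M) / 4"
        using measure_cauchy_core_le[OF \<beta> R_def nR fin] by (simp add: K_def M_def core)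
      have B: "measure M (B c) \<le> 4 * measure M (space M) / real n" for c
      proof -
        have "{..<n} \<noteq> {}" using n0 by auto
        then have "measure M (B c) \<le> 4 * measure M (space M) / card {..<n}"
          unfolding B_def
          by (intro measure_far_ball_le)
            (auto simp: finite_measure_axioms \<rho> M_def sets_cauchy_space
              intro: cauchy_space_flip cauchy_space_permute permutes_swap_id fin)
        then show ?thesis by simp
      qed
      have Km: "K \<in> sets M"
        using sets_cauchy_ball[of n \<beta> "\<lambda>_. 0"] by (simp add: K_def M_def)
      have "B c = {y \<in> space M. L2_set (\<lambda>i. y i - c i) {..<n} \<le> \<rho>} - {y \<in> space M. L2_set y {..<n} < 2 * \<rho>}" for c
        by (auto simp: B_def)
      moreover have "{y \<in> space M. L2_set y {..<n} < 2 * \<rho>} \<in> sets M"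
      proof -
        have "{y \<in> space (PiM {..<n} (\<lambda>_. lborel :: real measure)). L2_set y {..<n} < 2 * \<rho>}
            \<in> sets (PiM {..<n} (\<lambda>_. lborel))"
          unfolding L2_set_def by measurable
        then show ?thesis by (simp add: M_def msr_cauchy_space)
      qed
      ultimately have Bm: "B c \<in> sets M" for c
        using sets_cauchy_ball[of n \<beta> c \<rho>] by (auto simp: M_def)
      have "measure M (cauchy_balls n \<beta> C r) \<le> measure M (K \<union> (\<Union>c\<in>C. B c))"
      proof (rule finite_measure_mono)
        show "cauchy_balls n \<beta> C r \<subseteq> K \<union> (\<Union>c\<in>C. B c)"
          unfolding cauchy_balls_eq[OF n0] by (auto simp: K_def B_def M_def \<rho>_def)
        show "K \<union> (\<Union>c\<in>C. B c) \<in> sets M" using Km Bm C by auto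
      qed
      also have "\<dots> \<le> measure M K + measure M (\<Union>c\<in>C. B c)"
        using Km Bm C by (intro measure_Un_le) auto
      also have "measure M (\<Union>c\<in>C. B c) \<le> (\<Sum>c\<in>C. measure M (B c))"
        using Bm C by (intro measure_UNION_le) auto
      also have "\<dots> \<le> real (card C) * (4 * measure M (space M) / real n)"
        by (rule sum_bounded_above) (rule B)
      also have "\<dots> \<le> real N * (4 * measure M (space M) / real n)"
        using C by (intro mult_right_mono) auto
      also have "\<dots> = (16 * real N / real n) * (measure M (space M) / 4)"
        by simp
      also have "\<dots> \<le> 1 * (measure M (space M) / 4)"
        using n16 n0 by (intro mult_right_mono) (auto simp: divide_le_eq)
      finally show "measure (msr (cauchy_space n \<beta>)) (cauchy_balls n \<beta> C r)
         \<le> measure (msr (cauchy_space n \<beta>)) (space (msr (cauchy_space n \<beta>))) / 2"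
        using K by (simp add: M_def)
    qed
  qed
qed

section \<open>Finite nets in the limit space\<close>

text \<open>Balls about a countable dense set cover the space, so by continuity from below finitely
  many of them have mass close to 1.\<close>

lemma mm_space_finite_balls:
  assumes X: "mm_space X" and \<rho>: "0 < \<rho>" and \<eta>: "\<eta> < 1"
  obtains F where "finite F" "F \<subseteq> pts X"
    "\<eta> < measure (msr X) (\<Union>x\<in>F. Metric_space.mball (pts X) (dst X) x \<rho>)"
proof -
  interpret Metric_space "pts X" "dst X" using X by (simp add: mm_space_def)
  interpret P: prob_space "msr X" using X by (simp add: mm_space_def)
  have sp: "space (msr X) = pts X" using X by (simp add: mm_space_def)
  have ball: "mball x \<rho> \<in> sets (msr X)" for x
    using X openin_mball[of x \<rho>] by (simp add: mm_space_def sigma_sets.Basic)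
  obtain D where D: "countable D" "D \<subseteq> pts X" "mtopology closure_of D = pts X"
    using X by (auto simp: mm_space_def separable_space_def)
  \<comment> \<open>\<open>from_nat_into D\<close> is sure to take values in \<open>D\<close> only
    if \<open>D\<close> is nonempty; a space of mass 1 has a point.\<close>
  have "D \<noteq> {}" using D(3) P.not_empty sp by auto
  define A where "A m = (\<Union>j\<le>m. mball (from_nat_into D j) \<rho>)" for m
  have "(\<Union>m. A m) = pts X"
  proof (intro equalityI subsetI)
    fix y assume "y \<in> pts X"
    then obtain x where x: "x \<in> D" "x \<in> mball y \<rho>"
      using D(3) \<rho> by (fastforce simp: in_closure_of metric_closure_of)
    obtain j where "x = from_nat_into D j"
      using from_nat_into_surj[OF D(1) x(1)] by auto
    then have "y \<in> A j" using x by (auto simp: A_def commute)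
    then show "y \<in> (\<Union>m. A m)" by blast
  qed (auto simp: A_def)
  moreover have "(\<lambda>m. measure (msr X) (A m)) \<longlonglongrightarrow> measure (msr X) (\<Union>m. A m)"
    by (rule P.finite_Lim_measure_incseq) (use ball in \<open>force simp: A_def incseq_def\<close>)+
  ultimately have "(\<lambda>m. measure (msr X) (A m)) \<longlonglongrightarrow> 1"
    using P.prob_space by (simp add: sp)
  then obtain m where "\<eta> < measure (msr X) (A m)"
    using order_tendstoD(1)[OF _ \<eta>] by (metis eventually_sequentially order_refl)
  moreover have "A m = (\<Union>x\<in>from_nat_into D ` {..m}. mball x \<rho>)" by (auto simp: A_def)
  moreover have "from_nat_into D ` {..m} \<subseteq> pts X"
    using from_nat_into[OF \<open>D \<noteq> {}\<close>] D(2) by auto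
  ultimately show thesis by (intro that[of "from_nat_into D ` {..m}"]) auto
qed

text \<open>Each net point is replaced by the \<open>k\<close>-image of one parameter whose
  \<open>h\<close>-image is close to it. The triangle inequality is applied for \<open>d\<close>,
  and \<open>near\<close> carries the outcome over to \<open>d'\<close>. The box case takes
  parameters of the two spaces for \<open>h\<close> and \<open>k\<close>; the Gromov-Hausdorff case
  takes an almost isometry and the identity.\<close>

lemma finite_net_transfer:
  assumes M: "Metric_space M d" and F: "finite F"
    and h: "\<And>s. s \<in> J \<Longrightarrow> h s \<in> M" and FM: "F \<subseteq> M"
    and near: "\<And>s t. s \<in> J \<Longrightarrow> t \<in> J \<Longrightarrow> \<bar>d' (k s) (k t) - d (h s) (h t)\<bar> \<le> e"
  obtains C where "finite C" "card C \<le> card F"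
    "\<And>s x. s \<in> J \<Longrightarrow> x \<in> F \<Longrightarrow> d x (h s) < \<rho> \<Longrightarrow> \<exists>c\<in>C. d' (k s) c \<le> 2 * \<rho> + e"
proof -
  interpret Metric_space M d by (rule M)
  \<comment> \<open>If no such \<open>t\<close> exists, the choice is arbitrary and adds a harmless
    centre.\<close>
  define \<sigma> where "\<sigma> x = (SOME t. t \<in> J \<and> d x (h t) < \<rho>)" for x
  show thesis
  proof (rule that[of "(\<lambda>x. k (\<sigma> x)) ` F"])
    show "card ((\<lambda>x. k (\<sigma> x)) ` F) \<le> card F" by (rule card_image_le[OF F])
    fix s x assume s: "s \<in> J" and x: "x \<in> F" and lt: "d x (h s) < \<rho>"
    have \<sigma>: "\<sigma> x \<in> J \<and> d x (h (\<sigma> x)) < \<rho>"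
      unfolding \<sigma>_def by (rule someI[of _ s]) (use s lt in simp)
    have "d (h s) (h (\<sigma> x)) \<le> d x (h s) + d x (h (\<sigma> x))"
      using triangle[of "h s" x "h (\<sigma> x)"] h[OF s] h[of "\<sigma> x"] \<sigma> x FM commute[of "h s" x] by auto
    then have "d' (k s) (k (\<sigma> x)) \<le> 2 * \<rho> + e"
      using near[of s "\<sigma> x"] s \<sigma> lt by linarith
    then show "\<exists>c\<in>(\<lambda>x. k (\<sigma> x)) ` F. d' (k s) c \<le> 2 * \<rho> + e" using x by blast
  qed (use F in simp)
qed

section \<open>Non-convergence\<close>

lemma mm_scale_simps [simp]:
  "pts (mm_scale t X) = pts X" "msr (mm_scale t X) = msr X"
  by (simp_all add: mm_scale_def)

lemma prob_space_unit_lebesgue: "prob_space unit_lebesgue"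
  unfolding unit_lebesgue_def by (rule prob_space_restrict_space) auto

text \<open>A parameter exhibits the measure as an image of a probability measure. In the box case
  this gives the Cauchy measure mass 1 without evaluating its integral.\<close>

lemma prob_space_mm_parameter:
  assumes "mm_parameter X \<phi>"
  shows "prob_space (msr X)"
  using prob_space.prob_space_distr[OF prob_space_unit_lebesgue, of \<phi> "msr X"] assms
  by (simp add: mm_parameter_def)

text \<open>Finitely many balls of the limit space have mass above 7/8. On \<open>J\<close> the
  parameters carry them into equally many balls of the Cauchy space, which have mass at most
  1/2.\<close>

lemma not_box_converges_cauchy:
  fixes X :: "'a mm_triple"
  assumes \<beta>: "0 < \<beta>" and r: "strict_mono r" "\<And>k. 1 \<le> r k"
  shows "\<not> box_converges (\<lambda>k. mm_scale (1 / sqrt (real (r k))) (cauchy_space (r k) \<beta>)) X"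
    (is "\<not> box_converges ?Y X")
proof
  assume conv: "box_converges ?Y X"
  then have X: "mm_space X" by (simp add: box_converges_def)
  then interpret Metric_space "pts X" "dst X" by (simp add: mm_space_def)
  have sp: "space (msr X) = pts X" using X by (simp add: mm_space_def)
  obtain R where R: "0 < R" and small: "\<And>N. \<forall>\<^sub>F n in sequentially. \<forall>C. finite C \<longrightarrow> card C \<le> N \<longrightarrow>
       finite_measure (msr (cauchy_space n \<beta>)) \<longrightarrow> measure (msr (cauchy_space n \<beta>)) (cauchy_balls n \<beta> C R)
         \<le> measure (msr (cauchy_space n \<beta>)) (space (msr (cauchy_space n \<beta>))) / 2"
    using measure_cauchy_balls_le[OF \<beta>] by blast
  \<comment> \<open>\<open>3 * \<epsilon> \<le> R\<close> keeps the transferred radius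
    \<open>2 * \<epsilon> + e\<close> below \<open>R\<close>; \<open>\<epsilon> \<le> 1 / 8\<close>
    yields the final contradiction \<open>7 / 8 < 1 / 2 + e\<close>.\<close>
  define \<epsilon> where "\<epsilon> = min (R / 3) (1 / 8)"
  have \<epsilon>: "0 < \<epsilon>" "3 * \<epsilon> \<le> R" "\<epsilon> \<le> 1 / 8" using R by (auto simp: \<epsilon>_def)
  obtain F where F: "finite F" "F \<subseteq> pts X" "7 / 8 < measure (msr X) (\<Union>x\<in>F. mball x \<epsilon>)"
    by (rule mm_space_finite_balls[OF X \<epsilon>(1), of "7/8"]) auto
  have "\<forall>\<^sub>F k in sequentially. box_dist (?Y k) X < ennreal \<epsilon>"
    using conv \<epsilon> order_tendstoD(2)[of "\<lambda>k. box_dist (?Y k) X" 0 sequentially "ennreal \<epsilon>"]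
    by (simp add: box_converges_def)
  \<comment> \<open>The net lives in the limit space, so the number \<open>card F\<close> of balls
    is fixed before \<open>k\<close> is chosen.\<close>
  moreover have "\<forall>\<^sub>F k in sequentially. \<forall>C. finite C \<longrightarrow> card C \<le> card F \<longrightarrow>
       finite_measure (msr (cauchy_space (r k) \<beta>)) \<longrightarrow> measure (msr (cauchy_space (r k) \<beta>)) (cauchy_balls (r k) \<beta> C R)
         \<le> measure (msr (cauchy_space (r k) \<beta>)) (space (msr (cauchy_space (r k) \<beta>))) / 2"
    by (rule eventually_compose_filterlim[OF small filterlim_subseq[OF r(1)]])
  ultimately obtain k where box: "box_dist (?Y k) X < ennreal \<epsilon>" and
    smallk: "\<And>C. finite C \<Longrightarrow> card C \<le> card F \<Longrightarrow> finite_measure (msr (cauchy_space (r k) \<beta>)) \<Longrightarrow>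
       measure (msr (cauchy_space (r k) \<beta>)) (cauchy_balls (r k) \<beta> C R)
         \<le> measure (msr (cauchy_space (r k) \<beta>)) (space (msr (cauchy_space (r k) \<beta>))) / 2"
    using eventually_happens[OF eventually_conj] by force
  define n where "n = r k"
  have n: "0 < n" using r(2)[of k] by (simp add: n_def)
  let ?M = "msr (cauchy_space n \<beta>)"
  obtain e where "box_admissible (?Y k) X e" "ennreal e < ennreal \<epsilon>"
    using box by (auto simp: box_dist_def INF_less_iff)
  then obtain \<phi> \<psi> J where \<phi>: "mm_parameter (?Y k) \<phi>" and \<psi>: "mm_parameter X \<psi>"
    and J: "J \<in> sets borel" "J \<subseteq> {0..1}" "1 - e \<le> measure lborel J"
    and near: "\<And>s t. s \<in> J \<Longrightarrow> t \<in> J \<Longrightarrow> \<bar>dst (?Y k) (\<phi> s) (\<phi> t) - dst X (\<psi> s) (\<psi> t)\<bar> \<le> e"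
    and e: "e < \<epsilon>"
    using \<epsilon>(1) by (auto simp: box_admissible_def ennreal_less_iff)
  interpret U: prob_space unit_lebesgue by (rule prob_space_unit_lebesgue)
  interpret M: prob_space ?M using prob_space_mm_parameter[OF \<phi>] by (simp add: n_def)
  have spU: "space unit_lebesgue = {0..1}" by (simp add: unit_lebesgue_def space_restrict_space)
  have \<phi>m: "\<phi> \<in> unit_lebesgue \<rightarrow>\<^sub>M ?M" "distr unit_lebesgue ?M \<phi> = ?M"
    using \<phi> by (auto simp: mm_parameter_def n_def)
  have \<psi>m: "\<psi> \<in> unit_lebesgue \<rightarrow>\<^sub>M msr X" "distr unit_lebesgue (msr X) \<psi> = msr X"
    using \<psi> by (auto simp: mm_parameter_def)
  have JU: "J \<in> sets unit_lebesgue" "measure unit_lebesgue J = measure lborel J"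
    using J by (auto simp: unit_lebesgue_def sets_restrict_space_iff measure_restrict_space)
  have ball: "mball x \<epsilon> \<in> sets (msr X)" for x
    using X openin_mball[of x \<epsilon>] by (simp add: mm_space_def sigma_sets.Basic)
  obtain C where C: "finite C" "card C \<le> card F"
    "\<And>s x. s \<in> J \<Longrightarrow> x \<in> F \<Longrightarrow> dst X x (\<psi> s) < \<epsilon> \<Longrightarrow> \<exists>c\<in>C. dst (?Y k) (\<phi> s) c \<le> 2 * \<epsilon> + e"
  proof (rule finite_net_transfer[OF Metric_space_axioms F(1), of J \<psi> "dst (?Y k)" \<phi> e \<epsilon>])
    show "\<psi> s \<in> pts X" if "s \<in> J" for s
      using measurable_space[OF \<psi>m(1), of s] that J(2) by (auto simp: spU sp)
  qed (use F near in auto)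
  define V where "V = \<psi> -` (\<Union>x\<in>F. mball x \<epsilon>) \<inter> space unit_lebesgue"
  define W where "W = \<phi> -` cauchy_balls n \<beta> C R \<inter> space unit_lebesgue"
  have Us: "(\<Union>x\<in>F. mball x \<epsilon>) \<in> sets (msr X)" using F(1) ball by auto
  have V: "V \<in> sets unit_lebesgue" "7 / 8 < measure unit_lebesgue V"
    using F(3) measurable_sets[OF \<psi>m(1) Us] measure_distr[OF \<psi>m(1) Us] by (auto simp: V_def \<psi>m(2))
  note cb = sets_cauchy_balls[OF n C(1), of \<beta> R]
  have "measure unit_lebesgue W = measure ?M (cauchy_balls n \<beta> C R)"
    using measure_distr[OF \<phi>m(1) cb] by (simp add: W_def \<phi>m(2))
  also have "\<dots> \<le> 1 / 2"
    using smallk[OF C(1,2)] M.finite_measure_axioms M.prob_space by (simp add: n_def)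
  finally have W: "W \<in> sets unit_lebesgue" "measure unit_lebesgue W \<le> 1 / 2"
    using measurable_sets[OF \<phi>m(1) cb] by (auto simp: W_def)
  have "V \<inter> J \<subseteq> W"
  proof
    fix s assume s: "s \<in> V \<inter> J"
    then obtain x where "x \<in> F" "dst X x (\<psi> s) < \<epsilon>" by (auto simp: V_def)
    then obtain c where "c \<in> C" "dst (?Y k) (\<phi> s) c \<le> 2 * \<epsilon> + e" using C(3) s by blast
    moreover have "\<phi> s \<in> pts (cauchy_space n \<beta>)"
      using measurable_space[OF \<phi>m(1), of s] s by (auto simp: V_def space_cauchy_space)
    moreover have "2 * \<epsilon> + e \<le> R" using e \<epsilon>(2) by linarith
    ultimately have "\<phi> s \<in> cauchy_balls n \<beta> C R"
      unfolding cauchy_balls_def n_def by force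
    then show "s \<in> W" using s by (simp add: W_def V_def)
  qed
  \<comment> \<open>The complement of \<open>J\<close> has mass at most \<open>e\<close>.\<close>
  then have "V \<subseteq> W \<union> (space unit_lebesgue - J)" by (auto simp: V_def)
  then have "measure unit_lebesgue V \<le> measure unit_lebesgue (W \<union> (space unit_lebesgue - J))"
    using W JU by (intro U.finite_measure_mono) auto
  also have "\<dots> \<le> measure unit_lebesgue W + measure unit_lebesgue (space unit_lebesgue - J)"
    using W JU by (intro measure_Un_le) auto
  also have "\<dots> \<le> 1 / 2 + e"
    using W J JU by (simp add: U.prob_compl)
  finally show False using V(2) e \<epsilon>(3) by simp
qed

section \<open>The measured Gromov-Hausdorff case\<close>

lemma (in Metric_space) continuous_map_dist:
  assumes "x \<in> M"
  shows "continuous_map mtopology euclideanreal (d x)"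
  using continuous_on_mdist[of x Self] assms by (simp add: mtopology_of_def)

text \<open>The net argument again, with the almost isometries in place of parameters. Weak
  convergence tests continuous functions, so a bump function around the net stands in for the
  indicator of the balls.\<close>

lemma not_mGH_converges_cauchy:
  fixes X :: "'a mm_triple"
  assumes \<beta>: "0 < \<beta>" and r: "strict_mono r" "\<And>k. 1 \<le> r k"
  shows "\<not> mGH_converges (\<lambda>k. mm_scale (1 / sqrt (real (r k))) (cauchy_space (r k) \<beta>)) X"
    (is "\<not> mGH_converges ?Y X")
proof
  assume conv: "mGH_converges ?Y X"
  then have X: "mm_space X" by (simp add: mGH_converges_def)
  then interpret Metric_space "pts X" "dst X" by (simp add: mm_space_def)
  interpret P: prob_space "msr X" using X by (simp add: mm_space_def)
  have sp: "space (msr X) = pts X" using X by (simp add: mm_space_def)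
  have opens: "U \<in> sets (msr X)" if "openin mtopology U" for U
    using X that by (simp add: mm_space_def sigma_sets.Basic)
  obtain \<epsilon> f where \<epsilon>: "\<epsilon> \<longlonglongrightarrow> 0" and f': "\<forall>k. f k \<in> msr (?Y k) \<rightarrow>\<^sub>M msr X"
    and near': "\<forall>k. \<forall>x\<in>pts (?Y k). \<forall>x'\<in>pts (?Y k).
         \<bar>dst X (f k x) (f k x') - dst (?Y k) x x'\<bar> \<le> \<epsilon> k"
    and weak': "mm_weak_conv X (\<lambda>k. distr (msr (?Y k)) (msr X) (f k))"
    using conv unfolding mGH_converges_def by blast
  have f: "f k \<in> msr (cauchy_space (r k) \<beta>) \<rightarrow>\<^sub>M msr X" for k
    using f' by simp
  have near: "\<bar>dst (?Y k) x x' - dst X (f k x) (f k x')\<bar> \<le> \<epsilon> k"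
    if "x \<in> pts (cauchy_space (r k) \<beta>)" "x' \<in> pts (cauchy_space (r k) \<beta>)" for k x x'
    unfolding abs_minus_commute[of "dst (?Y k) x x'"] using near' that by simp
  have weak: "mm_weak_conv X (\<lambda>k. distr (msr (cauchy_space (r k) \<beta>)) (msr X) (f k))"
    using weak' by simp
  obtain R where R: "0 < R" and small: "\<And>N. \<forall>\<^sub>F n in sequentially. \<forall>C. finite C \<longrightarrow> card C \<le> N \<longrightarrow>
       finite_measure (msr (cauchy_space n \<beta>)) \<longrightarrow> measure (msr (cauchy_space n \<beta>)) (cauchy_balls n \<beta> C R)
         \<le> measure (msr (cauchy_space n \<beta>)) (space (msr (cauchy_space n \<beta>))) / 2"
    using measure_cauchy_balls_le[OF \<beta>] by blast
  \<comment> \<open>The bump function reaches out to \<open>2 * \<rho>\<close>, so the transferred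
    radius is \<open>2 * (2 * \<rho>) + \<epsilon> k\<close>, which is below
    \<open>5 * \<rho>\<close> once \<open>\<epsilon> k < \<rho>\<close>.\<close>
  define \<rho> where "\<rho> = R / 5"
  have \<rho>: "0 < \<rho>" using R by (simp add: \<rho>_def)
  obtain F where F: "finite F" "F \<subseteq> pts X" "7 / 8 < measure (msr X) (\<Union>x\<in>F. mball x \<rho>)"
    by (rule mm_space_finite_balls[OF X \<rho>, of "7/8"]) auto
  \<comment> \<open>Each summand is at least 1 within \<open>\<rho>\<close> of its centre and
    vanishes from distance \<open>2 * \<rho>\<close> on; the minimum keeps \<open>g\<close> between
    0 and 1.\<close>
  define g where "g y = min 1 (\<Sum>x\<in>F. max 0 (2 - (1 / \<rho>) * dst X x y))" for y
  have g01: "0 \<le> g y" "g y \<le> 1" for y by (auto simp: g_def sum_nonneg)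
  have g1: "g y = 1" if "y \<in> (\<Union>x\<in>F. mball x \<rho>)" for y
  proof -
    obtain x where x: "x \<in> F" "dst X x y < \<rho>" using \<open>y \<in> _\<close> by auto
    then have "1 \<le> max 0 (2 - (1 / \<rho>) * dst X x y)" using \<rho> by (simp add: field_simps)
    also have "\<dots> \<le> (\<Sum>x\<in>F. max 0 (2 - (1 / \<rho>) * dst X x y))"
      by (rule member_le_sum) (use x F in auto)
    finally show ?thesis by (simp add: g_def)
  qed
  have g0: "\<exists>x\<in>F. dst X x y < 2 * \<rho>" if "g y \<noteq> 0" for y
  proof (rule ccontr)
    assume "\<not> ?thesis"
    then have "max 0 (2 - (1 / \<rho>) * dst X x y) = 0" if "x \<in> F" for x
      using \<rho> that by (force simp: field_simps max_def)
    then have "g y = 0" by (simp add: g_def)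
    then show False using that by simp
  qed
  have g_cont: "continuous_map mtopology euclideanreal g"
    unfolding g_def using F
    by (intro continuous_map_real_min continuous_map_sum continuous_map_real_max continuous_map_diff
        continuous_map_real_mult continuous_map_const[THEN iffD2] continuous_map_dist) auto
  have g_meas: "g \<in> borel_measurable (msr X)"
  proof (rule borel_measurableI)
    fix S :: "real set" assume "open S"
    then have "openin mtopology {y \<in> pts X. g y \<in> S}"
      using openin_continuous_map_preimage[OF g_cont] by simp
    moreover have "{y \<in> pts X. g y \<in> S} = g -` S \<inter> space (msr X)" by (auto simp: sp)
    ultimately show "g -` S \<inter> space (msr X) \<in> sets (msr X)" using opens by simp
  qed
  have "7 / 8 < measure (msr X) (\<Union>x\<in>F. mball x \<rho>)" by (rule F(3))
  also have "\<dots> = (\<integral>y. indicator (\<Union>x\<in>F. mball x \<rho>) y \<partial>msr X)"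
    using F(1) opens by (simp add: sets.finite_UN)
  also have "\<dots> \<le> integral\<^sup>L (msr X) g"
  proof (rule integral_mono)
    show "integrable (msr X) g"
      by (rule P.integrable_const_bound[of _ 1]) (use g01 g_meas in auto)
    show "indicator (\<Union>x\<in>F. mball x \<rho>) y \<le> g y" for y
      using g01[of y] g1[of y] by (auto simp: indicator_def)
    show "integrable (msr X) (indicator (\<Union>x\<in>F. mball x \<rho>) :: _ \<Rightarrow> real)"
      using F(1) opens by (intro integrable_real_indicator) (auto simp: P.emeasure_eq_measure)
  qed
  finally have int_g: "7 / 8 < integral\<^sup>L (msr X) g" .
  let ?M = "\<lambda>k. msr (cauchy_space (r k) \<beta>)"
  have bdd: "bounded (g ` pts X)"
    by (rule boundedI[of _ 1]) (use g01 in auto)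
  have "(\<lambda>k. integral\<^sup>L (distr (?M k) (msr X) (f k)) g) \<longlonglongrightarrow> integral\<^sup>L (msr X) g"
    using weak g_cont bdd by (simp add: mm_weak_conv_def)
  then have "\<forall>\<^sub>F k in sequentially. 7 / 8 < integral\<^sup>L (distr (?M k) (msr X) (f k)) g"
    using int_g by (rule order_tendstoD(1))
  then have ev_g: "\<forall>\<^sub>F k in sequentially. 7 / 8 < (\<integral>x. g (f k x) \<partial>?M k)"
    by (simp add: integral_distr[OF f g_meas])
  \<comment> \<open>Testing the constant function 1 shows that the total masses of the Cauchy
    measures tend to 1.\<close>
  have "(\<lambda>k. \<integral>y. (1 :: real) \<partial>distr (?M k) (msr X) (f k)) \<longlonglongrightarrow> (\<integral>y. 1 \<partial>msr X)"
  proof -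
    have "bounded ((\<lambda>_. 1 :: real) ` pts X)" by (rule boundedI[of _ 1]) auto
    then show ?thesis
      using weak[unfolded mm_weak_conv_def, rule_format, of "\<lambda>_. 1"]
      by (simp only: continuous_map_const) simp
  qed
  then have total: "(\<lambda>k. measure (?M k) (space (?M k))) \<longlonglongrightarrow> 1"
    by (subst (asm) integral_distr[OF f]) (simp_all add: P.prob_space)
  \<comment> \<open>The lower bound on the mass gives finiteness; the upper bound gives the balls
    mass below 5/8, against an integral above 7/8.\<close>
  have "\<forall>\<^sub>F k in sequentially. \<epsilon> k < \<rho> \<and> 1 / 2 < measure (?M k) (space (?M k)) \<and>
     measure (?M k) (space (?M k)) < 5 / 4"
    using order_tendstoD(2)[OF \<epsilon> \<rho>] order_tendstoD(1)[OF total, of "1/2"] order_tendstoD(2)[OF total, of "5/4"]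
    by (auto intro: eventually_conj)
  moreover have "\<forall>\<^sub>F k in sequentially. \<forall>C. finite C \<longrightarrow> card C \<le> card F \<longrightarrow>
       finite_measure (?M k) \<longrightarrow> measure (?M k) (cauchy_balls (r k) \<beta> C R) \<le> measure (?M k) (space (?M k)) / 2"
    by (rule eventually_compose_filterlim[OF small filterlim_subseq[OF r(1)]])
  ultimately have "\<forall>\<^sub>F k in sequentially. False"
    using ev_g
  proof eventually_elim
    case (elim k)
    \<comment> \<open>\<open>measure\<close> is 0 where the mass is infinite, so a positive value
      proves finiteness.\<close>
    have fin: "finite_measure (?M k)"
      using elim(1) by (intro finite_measureI) (auto simp: measure_def)
    interpret M: finite_measure "?M k" by (rule fin)
    have fX: "f k s \<in> pts X" if "s \<in> pts (cauchy_space (r k) \<beta>)" for s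
      using measurable_space[OF f, of s k] that by (simp add: sp space_cauchy_space)
    obtain C where C: "finite C" "card C \<le> card F"
      "\<And>s x. s \<in> pts (cauchy_space (r k) \<beta>) \<Longrightarrow> x \<in> F \<Longrightarrow> dst X x (f k s) < 2 * \<rho> \<Longrightarrow>
        \<exists>c\<in>C. dst (?Y k) s c \<le> 2 * (2 * \<rho>) + \<epsilon> k"
      by (rule finite_net_transfer[OF Metric_space_axioms F(1), of "pts (cauchy_space (r k) \<beta>)" "f k"
            "dst (?Y k)" "\<lambda>x. x" "\<epsilon> k" "2 * \<rho>"])
        (use F(2) fX near in blast)+
    let ?W = "cauchy_balls (r k) \<beta> C R"
    have W: "?W \<in> sets (?M k)" using r(2)[of k] C(1) by (intro sets_cauchy_balls) auto
    have "(\<integral>x. g (f k x) \<partial>?M k) \<le> (\<integral>x. indicator ?W x \<partial>?M k)"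
    proof (rule integral_mono)
      show "integrable (?M k) (\<lambda>x. g (f k x))"
        by (rule M.integrable_const_bound[of _ 1]) (use g01 measurable_compose[OF f g_meas] in auto)
      show "integrable (?M k) (indicator ?W :: _ \<Rightarrow> real)"
        using W by (intro integrable_real_indicator) (auto simp: M.emeasure_eq_measure)
      fix x assume x: "x \<in> space (?M k)"
      show "g (f k x) \<le> indicator ?W x"
      proof (cases "g (f k x) = 0")
        case False
        then obtain y where "y \<in> F" "dst X y (f k x) < 2 * \<rho>" using g0 by blast
        then obtain c where "c \<in> C" "dst (?Y k) x c \<le> 2 * (2 * \<rho>) + \<epsilon> k"
          using C(3) x by (metis space_cauchy_space)
        moreover have "2 * (2 * \<rho>) + \<epsilon> k \<le> R" using elim(1) by (simp add: \<rho>_def)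
        ultimately have "x \<in> ?W" using x by (force simp: cauchy_balls_def space_cauchy_space)
        then show ?thesis using g01 by simp
      qed simp
    qed
    also have "\<dots> = measure (?M k) ?W" using W by simp
    also have "\<dots> \<le> measure (?M k) (space (?M k)) / 2" using elim(2) C fin by blast
    finally show False using elim by simp
  qed
  then show False by simp
qed

theorem theorem1p8:
  fixes \<beta> :: real
  assumes "\<beta> > 0"
  shows "\<not> (\<exists>(r :: nat \<Rightarrow> nat) (X :: 'a mm_triple). strict_mono r \<and> (\<forall>k. 1 \<le> r k) \<and>
             box_converges (\<lambda>k. mm_scale (1 / sqrt (real (r k))) (cauchy_space (r k) \<beta>)) X) \<and>
         \<not> (\<exists>(r :: nat \<Rightarrow> nat) (X :: 'a mm_triple). strict_mono r \<and> (\<forall>k. 1 \<le> r k) \<and>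
             mGH_converges (\<lambda>k. mm_scale (1 / sqrt (real (r k))) (cauchy_space (r k) \<beta>)) X)"
  using not_box_converges_cauchy[OF assms] not_mGH_converges_cauchy[OF assms] by blast

end
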